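(* Let $\lambda$ be a real number with $\lambda>-1$, $\lambda\neq0$, and let $x$ be a real number. For every integer $k\ge0$, \[ \mathrm{Bel}_{k,\lambda}(x)=(1+\lambda)^{-\frac{x}{\lambda}}\sum_{l=0}^{\infty}\frac{x^{l}}{l!}\left(\frac{\log(1+\lambda)}{\lambda}\right)^{l}(l\mid\lambda)_{k}. \]
   Context: The degenerate Bell polynomials $\mathrm{Bel}_{n,\lambda}(x)$ are defined by \[ (1+\lambda)^{\frac{x}{\lambda}\left((1+\lambda t)^{1/\lambda}-1\right)}=\exp\!\Big(\tfrac{x}{\lambda}\log(1+\lambda)\big((1+\lambda t)^{1/\lambda}-1\big)\Big)=\sum_{n=0}^{\infty}\mathrm{Bel}_{n,\lambda}(x)\frac{t^{n}}{n!}, \] with $(1+\lambda t)^{1/\lambda}=\exp(\tfrac1\lambda\log(1+\lambda t))$. For a number $a$, $(a\mid\lambda)_0=1$ and $(a\mid\lambda)_k=a(a-\lambda)(a-2\lambda)\cdots(a-(k-1)\lambda)$ for $k\ge1$. *)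

theory Defs
  imports "HOL-Complex_Analysis.Complex_Analysis"
begin

definition gen_falling :: "real \<Rightarrow> real \<Rightarrow> nat \<Rightarrow> real" where
  "gen_falling a lam k = (\<Prod>i<k. a - real i * lam)"

(* (1 + lam t)^(1/lam) = exp (log (1 + lam t) / lam) as a power series in t *)
definition degenerate_exp_fps :: "real \<Rightarrow> real fps" where
  "degenerate_exp_fps lam = fps_exp (1 / lam) oo (fps_ln 1 oo (fps_const lam * fps_X))"

definition degenerate_bell_gf :: "real \<Rightarrow> real \<Rightarrow> real fps" where
  "degenerate_bell_gf lam x =
     fps_exp (x / lam * ln (1 + lam)) oo (degenerate_exp_fps lam - 1)"

definition degenerate_bell :: "nat \<Rightarrow> real \<Rightarrow> real \<Rightarrow> real" where
  "degenerate_bell n lam x = fact n * fps_nth (degenerate_bell_gf lam x) n"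

(* The remainder of this theory shows that the formal generating function converges near 0
   to the real function t |-> (1 + lam) powr (x / lam * ((1 + lam * t) powr (1 / lam) - 1)). *)

definition fps_of_real :: "real fps \<Rightarrow> complex fps" where
  "fps_of_real F = Abs_fps (\<lambda>n. of_real (fps_nth F n))"

lemma fps_of_real_nth [simp]: "fps_nth (fps_of_real F) n = of_real (fps_nth F n)"
  by (simp add: fps_of_real_def)

lemma fps_of_real_mult: "fps_of_real (F * G) = fps_of_real F * fps_of_real G"
  by (rule fps_ext) (simp add: fps_mult_nth)

lemma fps_of_real_1: "fps_of_real 1 = 1"
  by (rule fps_ext) simp

lemma fps_of_real_power: "fps_of_real (F ^ n) = fps_of_real F ^ n"
  by (induction n) (simp_all add: fps_of_real_mult fps_of_real_1)

lemma fps_of_real_diff: "fps_of_real (F - G) = fps_of_real F - fps_of_real G"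
  by (rule fps_ext) simp

lemma fps_of_real_compose: "fps_of_real (F oo G) = fps_of_real F oo fps_of_real G"
  by (rule fps_ext) (simp add: fps_compose_nth fps_of_real_power [symmetric])

lemma fps_of_real_exp: "fps_of_real (fps_exp c) = fps_exp (of_real c)"
  by (rule fps_ext) simp

lemma fps_of_real_ln: "fps_of_real (fps_ln 1) = fps_ln 1"
  by (rule fps_ext) (simp add: fps_ln_def)

lemma fps_of_real_linear: "fps_of_real (fps_const c * fps_X) = fps_const (of_real c) * fps_X"
  by (rule fps_ext) (simp add: fps_X_def)

lemma has_fps_expansion_ln_complex: "(\<lambda>z::complex. ln (1 + z)) has_fps_expansion fps_ln 1"
proof -
  have "eval_fps (fps_ln 1) z = ln (1 + z)" if "norm z < 1" for z :: complex
  proof -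
    have "(\<lambda>n. (-1) ^ Suc n / of_nat n * z ^ n) sums ln (1 + z)"
      by (rule Ln_series [OF that])
    also have "(\<lambda>n. (-1) ^ Suc n / of_nat n * z ^ n) = (\<lambda>n. fps_nth (fps_ln 1) n * z ^ n)"
      by (rule ext, case_tac n) (simp_all add: fps_ln_def)
    finally show ?thesis by (simp add: sums_iff eval_fps_def)
  qed
  moreover have "eventually (\<lambda>z::complex. z \<in> ball 0 1) (nhds 0)"
    by (intro eventually_nhds_in_open) auto
  ultimately show ?thesis
    by (auto simp: has_fps_expansion_def elim!: eventually_mono)
qed

lemma degenerate_bell_gf_sums:
  assumes "lam > -1" "lam \<noteq> 0"
  shows "eventually (\<lambda>t. (\<lambda>n. degenerate_bell n lam x * (t ^ n / fact n)) sums
           ((1 + lam) powr (x / lam * ((1 + lam * t) powr (1 / lam) - 1)))) (nhds 0)"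
proof -
  define c where "c = x / lam * ln (1 + lam)"
  define H where "H = fps_of_real (degenerate_bell_gf lam x)"
  define h where "h = (\<lambda>w. exp (complex_of_real c * w)) \<circ> (\<lambda>z. ((\<lambda>w. exp (of_real (1 / lam) * w)) \<circ>
     ((\<lambda>z. ln (1 + z)) \<circ> (\<lambda>z. of_real lam * z))) z - 1)"
  have H_eq: "H = fps_exp (of_real c) oo ((fps_exp (of_real (1 / lam)) oo
               (fps_ln 1 oo (fps_const (of_real lam) * fps_X))) - 1)"
    unfolding H_def degenerate_bell_gf_def degenerate_exp_fps_def c_def
    by (simp only: fps_of_real_compose fps_of_real_diff fps_of_real_exp fps_of_real_ln
          fps_of_real_linear fps_of_real_1)
  have H: "h has_fps_expansion H"
    unfolding H_eq h_def
    by (intro has_fps_expansion_compose has_fps_expansion_exp has_fps_expansion_diff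
          has_fps_expansion_ln_complex has_fps_expansion_cmult_left has_fps_expansion_fps_X
          has_fps_expansion_1)
       (simp_all add: fps_ln_def)
  have "eventually (\<lambda>z. z \<in> eball 0 (fps_conv_radius H)) (nhds 0)"
    using H by (intro eventually_nhds_in_open) (auto simp: has_fps_expansion_def zero_ereal_def)
  moreover have "eventually (\<lambda>z. eval_fps H z = h z) (nhds 0)"
    using H by (simp add: has_fps_expansion_def)
  ultimately have "eventually (\<lambda>z. (\<lambda>n. fps_nth H n * z ^ n) sums h z) (nhds 0)"
  proof eventually_elim
    case (elim z)
    then show ?case using sums_eval_fps [of z H] by (simp add: in_eball_iff)
  qed
  moreover have "filterlim complex_of_real (nhds 0) (nhds 0)"
  proof -
    have "((\<lambda>t. complex_of_real t) \<longlongrightarrow> of_real 0) (nhds 0)"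
      by (intro tendsto_of_real filterlim_ident)
    then show ?thesis by simp
  qed
  ultimately have ev: "eventually (\<lambda>t. (\<lambda>n. fps_nth H n * of_real t ^ n) sums h (of_real t)) (nhds (0::real))"
    by (rule eventually_compose_filterlim)
  have "eventually (\<lambda>t::real. 1 + lam * t > 0) (nhds 0)"
  proof (rule order_tendstoD)
    show "((\<lambda>t. 1 + lam * t) \<longlongrightarrow> 1 + lam * 0) (nhds 0)" by (intro tendsto_intros filterlim_ident)
  qed simp
  with ev show ?thesis
  proof eventually_elim
    case (elim t)
    define y where "y = (1 + lam) powr (x / lam * ((1 + lam * t) powr (1 / lam) - 1))"
    have "h (of_real t) = of_real (exp (c * (exp (1 / lam * ln (1 + lam * t)) - 1)))"
    proof -
      have "ln (1 + of_real lam * of_real t) = complex_of_real (ln (1 + lam * t))"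
        using Ln_of_real [OF elim(2)] by simp
      then show ?thesis by (simp add: h_def exp_of_real [symmetric])
    qed
    also have "exp (c * (exp (1 / lam * ln (1 + lam * t)) - 1)) = y"
      using assms elim(2) by (simp add: y_def c_def powr_def mult_ac)
    finally have "h (of_real t) = of_real y" .
    with elim(1) have "(\<lambda>n. complex_of_real (fps_nth (degenerate_bell_gf lam x) n * t ^ n)) sums of_real y"
      by (simp add: H_def)
    then have "(\<lambda>n. fps_nth (degenerate_bell_gf lam x) n * t ^ n) sums y"
      by (simp only: sums_of_real_iff)
    then show ?case by (simp add: degenerate_bell_def y_def)
  qed
qed

end

theory Submission
  imports Defs
begin

text \<open>
  Write \<open>E\<close> for the series \<open>(1 + \<lambda>t)\<^bsup>1/\<lambda>\<^esup>\<close> and \<open>c = x ln (1 + \<lambda>) / \<lambda>\<close>. The coefficients of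
  \<open>E\<^sup>l\<close> are \<open>(l | \<lambda>)\<^sub>k / k!\<close> by the binomial series. Since \<open>E - 1\<close> has no constant term, the sum over
  \<open>j\<close> of \<open>c\<^sup>j / j!\<close> times the \<open>k\<close>-th coefficient of \<open>(E - 1)\<^sup>j\<close> is finite; expanding \<open>(E - 1)\<^sup>j\<close> by
  the binomial theorem exhibits it as the Cauchy product of the series for \<open>exp (-c)\<close> with the
  absolutely convergent series of all \<open>c\<^sup>l / l! (l | \<lambda>)\<^sub>k / k!\<close>.
\<close>

text \<open>Both sides solve \<open>(1 + X) F' = a F\<close> with constant coefficient 1, and this
  determines the series.\<close>

lemma fps_exp_compose_ln_eq_binomial:
  fixes a :: "'a :: field_char_0"
  shows "fps_exp a oo fps_ln 1 = fps_binomial a"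
proof -
  define F where "F = fps_exp a oo fps_ln (1::'a)"
  have "fps_deriv F = fps_const a * F * inverse (1 + fps_X)"
    unfolding F_def
    by (subst fps_compose_deriv) (simp_all add: fps_ln_deriv fps_compose_mult_distrib)
  also have "\<dots> = fps_const a * F / (1 + fps_X)"
    by (simp add: fps_divide_unit)
  finally have "F = fps_const (fps_nth F 0) * fps_binomial a"
    by (subst (asm) fps_binomial_ODE_unique)
  moreover have "fps_nth F 0 = 1"
    by (simp add: F_def)
  ultimately show ?thesis
    by (simp add: F_def)
qed

lemma degenerate_exp_fps_power:
  "degenerate_exp_fps lam ^ l = fps_binomial (real l / lam) oo (fps_const lam * fps_X)"
proof -
  have "degenerate_exp_fps lam = fps_binomial (1 / lam) oo (fps_const lam * fps_X)"
    by (simp add: degenerate_exp_fps_def fps_compose_assoc flip: fps_exp_compose_ln_eq_binomial)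
  then show ?thesis
    by (simp add: fps_binomial_power fps_compose_power)
qed

text \<open>Scaling the variable contributes \<open>lam ^ k\<close>. Giving one \<open>lam\<close>
  to each of the \<open>k\<close> factors of the generalized binomial coefficient turns
  \<open>l / lam - i\<close> into \<open>l - i * lam\<close>.\<close>

lemma degenerate_exp_fps_power_nth:
  assumes "lam \<noteq> 0"
  shows "fps_nth (degenerate_exp_fps lam ^ l) k = gen_falling (real l) lam k / fact k"
proof -
  have "fps_nth (degenerate_exp_fps lam ^ l) k = lam ^ k * (real l / lam gchoose k)"
    by (simp add: degenerate_exp_fps_power fps_compose_linear)
  also have "\<dots> = (\<Prod>i<k. lam * (real l / lam - real i)) / fact k"
    by (simp add: gbinomial_prod_rev prod.distrib atLeast0LessThan)
  also have "(\<Prod>i<k. lam * (real l / lam - real i)) = gen_falling (real l) lam k"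
    unfolding gen_falling_def using assms by (intro prod.cong) (simp_all add: field_simps)
  finally show ?thesis .
qed

text \<open>A crude bound suffices for summability: each of the \<open>k\<close> factors is at most
  a constant times \<open>exp l\<close>, so growth in \<open>l\<close> is at most geometric with
  ratio \<open>exp k\<close>.\<close>

lemma abs_gen_falling_le:
  "\<bar>gen_falling (real l) lam k\<bar> \<le> (\<Prod>i<k. 1 + real i * \<bar>lam\<bar>) * (exp (real k)) ^ l"
proof -
  have "\<bar>real l - real i * lam\<bar> \<le> (1 + real i * \<bar>lam\<bar>) * exp (real l)" for i
  proof -
    \<comment> \<open>The factor 1 is kept so that the next step can replace it by the larger
      \<open>exp (real l)\<close>.\<close>
    have "\<bar>real l - real i * lam\<bar> \<le> real l + real i * \<bar>lam\<bar> * 1"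
      using abs_triangle_ineq4[of "real l" "real i * lam"] by (simp add: abs_mult)
    also have "\<dots> \<le> exp (real l) + real i * \<bar>lam\<bar> * exp (real l)"
      using exp_ge_add_one_self[of "real l"] by (intro add_mono mult_left_mono) (linarith | simp)+
    finally show ?thesis
      by (simp add: algebra_simps)
  qed
  then have "\<bar>gen_falling (real l) lam k\<bar> \<le> (\<Prod>i<k. (1 + real i * \<bar>lam\<bar>) * exp (real l))"
    unfolding gen_falling_def abs_prod by (intro prod_mono) auto
  also have "\<dots> = (\<Prod>i<k. 1 + real i * \<bar>lam\<bar>) * (exp (real k)) ^ l"
    by (simp add: prod.distrib mult.commute flip: exp_of_nat_mult)
  finally show ?thesis .
qed

text \<open>The geometric bound makes a multiple of the exponential series at
  \<open>\<bar>c\<bar> * exp k\<close> a majorant.\<close>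

lemma summable_abs_exp_gen_falling:
  "summable (\<lambda>l. \<bar>c ^ l / fact l * gen_falling (real l) lam k\<bar>)"
proof (rule summable_comparison_test)
  define P where "P = (\<Prod>i<k. 1 + real i * \<bar>lam\<bar>)"
  show "summable (\<lambda>l. P * (inverse (fact l) * (\<bar>c\<bar> * exp (real k)) ^ l))"
    by (intro summable_mult summable_exp)
  have "\<bar>c ^ l / fact l * gen_falling (real l) lam k\<bar>
      \<le> P * (inverse (fact l) * (\<bar>c\<bar> * exp (real k)) ^ l)" for l
  proof -
    have "\<bar>c ^ l / fact l * gen_falling (real l) lam k\<bar>
        \<le> \<bar>c\<bar> ^ l / fact l * (P * exp (real k) ^ l)"
      unfolding abs_mult P_def by (rule mult_mono[OF _ abs_gen_falling_le]) (simp_all add: power_abs)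
    then show ?thesis
      by (simp add: power_mult_distrib field_simps)
  qed
  then show "\<exists>N. \<forall>l\<ge>N. norm \<bar>c ^ l / fact l * gen_falling (real l) lam k\<bar>
      \<le> P * (inverse (fact l) * (\<bar>c\<bar> * exp (real k)) ^ l)"
    by simp
qed

lemma fps_exp_compose_minus_one_nth:
  fixes E :: "real fps"
  assumes "fps_nth E 0 = 1" and "summable (\<lambda>l. \<bar>c ^ l / fact l * fps_nth (E ^ l) k\<bar>)"
  shows "fps_nth (fps_exp c oo (E - 1)) k = exp (- c) * (\<Sum>l. c ^ l / fact l * fps_nth (E ^ l) k)"
proof -
  define a where "a l = c ^ l / fact l * fps_nth (E ^ l) k" for l
  define b where "b l = (- c) ^ l / fact l" for l
  \<comment> \<open>The \<open>j!\<close> cancels against the binomial coefficient, leaving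
    \<open>1 / (i! (j - i)!)\<close>; the sign is absorbed into the powers of
    \<open>- c\<close>.\<close>
  have expand: "c ^ j / fact j * fps_nth ((E - 1) ^ j) k = (\<Sum>i\<le>j. a i * b (j - i))" for j
  proof -
    have "(E - 1) ^ j = (\<Sum>i\<le>j. of_nat (j choose i) * E ^ i * (- 1) ^ (j - i))"
      using binomial_ring[of E "- 1" j] by simp
    also have "\<dots> = (\<Sum>i\<le>j. fps_const (real (j choose i) * (- 1) ^ (j - i)) * E ^ i)"
      by (intro sum.cong) (simp_all add: fps_of_nat mult_ac flip: fps_const_power fps_const_mult fps_const_neg)
    finally have "c ^ j / fact j * fps_nth ((E - 1) ^ j) k
        = (\<Sum>i\<le>j. c ^ j / fact j * (real (j choose i) * (- 1) ^ (j - i) * fps_nth (E ^ i) k))"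
      by (simp add: fps_sum_nth sum_distrib_left)
    also have "\<dots> = (\<Sum>i\<le>j. a i * b (j - i))"
    proof (rule sum.cong)
      fix i assume "i \<in> {..j}"
      then have "i \<le> j" by simp
      moreover from this have "c ^ j = c ^ i * c ^ (j - i)"
        by (simp flip: power_add)
      ultimately show "c ^ j / fact j * (real (j choose i) * (- 1) ^ (j - i) * fps_nth (E ^ i) k)
          = a i * b (j - i)"
        by (simp add: a_def b_def binomial_fact power_minus[of c])
    qed simp
    finally show ?thesis .
  qed
  have exp_sums: "b sums exp (- c)"
    using exp_converges[of "- c"] by (simp add: b_def[abs_def] divide_inverse mult.commute)
  have "summable (\<lambda>l. norm (b l))"
    using summable_norm_exp[of "- c"] by (simp add: b_def[abs_def] divide_inverse mult.commute)
  then have "(\<lambda>j. \<Sum>i\<le>j. a i * b (j - i)) sums ((\<Sum>l. a l) * (\<Sum>l. b l))"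
    using assms(2) by (intro Cauchy_product_sums) (simp_all add: a_def)
  then have "(\<lambda>j. c ^ j / fact j * fps_nth ((E - 1) ^ j) k) sums ((\<Sum>l. a l) * exp (- c))"
    by (simp only: expand sums_unique[OF exp_sums])
  \<comment> \<open>Since \<open>E - 1\<close> has no constant term, \<open>(E - 1) ^ j\<close> has
    no coefficient below degree \<open>j\<close>, so terms with \<open>j > k\<close> vanish.
    Comparing the two sums of this series gives the claim.\<close>
  moreover have "(\<lambda>j. c ^ j / fact j * fps_nth ((E - 1) ^ j) k)
      sums (\<Sum>j\<in>{0..k}. c ^ j / fact j * fps_nth ((E - 1) ^ j) k)"
    using assms(1) by (intro sums_finite) (simp_all add: startsby_zero_power_prefix)
  ultimately have "(\<Sum>l. a l) * exp (- c) = (\<Sum>j\<in>{0..k}. c ^ j / fact j * fps_nth ((E - 1) ^ j) k)"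
    by (rule sums_unique2)
  then show ?thesis
    by (simp add: fps_compose_nth a_def mult.commute)
qed

theorem theorem6:
  fixes lam x :: real and k :: nat
  assumes "lam > -1" and "lam \<noteq> 0"
  shows "summable (\<lambda>l. x ^ l / fact l * (ln (1 + lam) / lam) ^ l * gen_falling (real l) lam k)
    \<and> degenerate_bell k lam x =
        (1 + lam) powr (- (x / lam)) *
        (\<Sum>l. x ^ l / fact l * (ln (1 + lam) / lam) ^ l * gen_falling (real l) lam k)"
proof -
  define c where "c = x / lam * ln (1 + lam)"
  have term_eq: "x ^ l / fact l * (ln (1 + lam) / lam) ^ l * gen_falling (real l) lam k
      = c ^ l / fact l * gen_falling (real l) lam k" for l
    by (simp add: c_def power_mult_distrib power_divide)
  have summable: "summable (\<lambda>l. c ^ l / fact l * gen_falling (real l) lam k)"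
    using summable_abs_exp_gen_falling by (rule summable_rabs_cancel)
  let ?E = "degenerate_exp_fps lam"
  \<comment> \<open>The divisor \<open>fact k\<close> will cancel the factor \<open>fact k\<close>
    in \<open>degenerate_bell\<close>.\<close>
  have coeff: "c ^ l / fact l * fps_nth (?E ^ l) k = c ^ l / fact l * gen_falling (real l) lam k / fact k" for l
    using assms(2) by (simp add: degenerate_exp_fps_power_nth)
  have "summable (\<lambda>l. \<bar>c ^ l / fact l * fps_nth (?E ^ l) k\<bar>)"
    unfolding coeff abs_divide[of _ "fact k"]
    by (rule summable_divide[OF summable_abs_exp_gen_falling])
  moreover have "fps_nth ?E 0 = 1"
    by (simp add: degenerate_exp_fps_def)
  ultimately have "fps_nth (degenerate_bell_gf lam x) k
      = exp (- c) * (\<Sum>l. c ^ l / fact l * fps_nth (?E ^ l) k)"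
    unfolding degenerate_bell_gf_def c_def by (intro fps_exp_compose_minus_one_nth)
  also have "\<dots> = exp (- c) * ((\<Sum>l. c ^ l / fact l * gen_falling (real l) lam k) / fact k)"
    unfolding coeff suminf_divide[OF summable] ..
  also have "exp (- c) = (1 + lam) powr (- (x / lam))"
    using assms(1) by (simp add: c_def powr_def)
  finally show ?thesis
    unfolding term_eq degenerate_bell_def using summable by simp
qed

end
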